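(* Every complex Hilbert space $H$ of finite dimension $n\ge2$ admits a bounded linear operator $T$ and a nontrivial subspace $\mathcal{M}$ of $H$ such that $T$ is $\mathcal{M}$-diskcyclic.
   Context: $\mathbb{D}=\{\alpha\in\mathbb{C}:|\alpha|\le1\}$. A subspace is nontrivial if it is neither $\{0\}$ nor the whole space. $T$ is $\mathcal{M}$-diskcyclic if there is $x\in H$ with $\{\alpha T^mx:\alpha\in\mathbb{D},m=0,1,2,\dots\}\cap\mathcal{M}$ dense in $\mathcal{M}$. *)

theory Defs
  imports "HOL-Analysis.Analysis"
begin

text \<open>The closed unit disk in the complex plane.\<close>
definition unit_disk :: "complex set" where
  "unit_disk = {\<alpha>. cmod \<alpha> \<le> 1}"

text \<open>T is M-diskcyclic: some x has disk orbit whose intersection with M is dense in M.\<close>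
definition M_diskcyclic ::
  "(complex ^ 'n \<Rightarrow> complex ^ 'n) \<Rightarrow> (complex ^ 'n) set \<Rightarrow> bool" where
  "M_diskcyclic T M \<longleftrightarrow> (\<exists>x. M \<subseteq> closure ({\<alpha> *s (T ^^ m) x | \<alpha> m. \<alpha> \<in> unit_disk} \<inter> M))"

end

theory Submission
  imports Defs
begin

(* Idea of the proof.  Diskcyclicity is impossible in finite dimension, but
   subspace-diskcyclicity is not: a dilation T v = c v with |c| > 1 is
   M-diskcyclic for every line M = span {x}.  Indeed T^m x = c^m x, and every
   point k x of the line equals (k / c^m) T^m x, where m is chosen so large that
   |k| < |c|^m; then k / c^m lies in the closed unit disk.  So the line is even
   contained in the disk orbit of x, which is more than the required density.

   It then shows that a line
   spanned by a nonzero vector is a nontrivial subspace as soon as the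
   dimension is at least 2, gives a sufficient criterion for M-diskcyclicity,
   and proves the key lemma about dilations.  The theorem takes T = 2 I and
   M the line through the first coordinate vector. *)

text \<open>Dilations of \<open>\<complex>\<^sup>n\<close>: linear over \<open>\<complex>\<close>, bounded, since they scale the norm by \<open>|c|\<close>.\<close>

lemma norm_vector_smult_complex: "norm (c *s (x :: complex ^ 'n)) = cmod c * norm x"
  unfolding norm_vec_def by (simp add: norm_mult L2_set_right_distrib)

lemma linear_dilation: "Vector_Spaces.linear (*s) (*s) ((*s) (c :: complex) :: complex ^ 'n \<Rightarrow> _)"
  by (rule vec.linear_scale_self)

lemma bounded_linear_dilation: "bounded_linear ((*s) (c :: complex) :: complex ^ 'n \<Rightarrow> _)"
proof (rule bounded_linear_intro[where K = "cmod c"])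
  fix x y :: "complex ^ 'n" and r :: real
  show "c *s (x + y) = c *s x + c *s y" by (rule vector_add_ldistrib)
  show "c *s (r *\<^sub>R x) = r *\<^sub>R (c *s x)"
    by (simp add: vec_eq_iff scaleR_conv_of_real)
  show "norm (c *s x) \<le> norm x * cmod c"
    by (simp add: norm_vector_smult_complex mult.commute)
qed

text \<open>The \<open>m\<close>-th iterate of the dilation by \<open>c\<close> is the dilation by \<open>c\<^sup>m\<close>.\<close>

lemma dilation_iterate: "((*s) c ^^ m) (v :: 'a :: comm_monoid_mult ^ 'n) = c ^ m *s v"
  by (induction m) (simp_all add: vector_smult_assoc)

text \<open>A line through a nonzero vector is a nontrivial subspace once the dimension is \<open>\<ge> 2\<close>:
  its dimension is 1, while the whole space has dimension \<open>CARD('n)\<close>.\<close>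

lemma span_singleton_nonzero:
  assumes "(x :: complex ^ 'n) \<noteq> 0"
  shows "vec.span {x} \<noteq> {0}"
  using assms vec.span_base[of x "{x}"] by auto

lemma span_singleton_not_UNIV:
  assumes "CARD('n :: finite) \<ge> 2"
  shows "vec.span {x :: complex ^ 'n} \<noteq> UNIV"
proof
  assume "vec.span {x} = UNIV"
  then have "vec.dim (UNIV :: (complex ^ 'n) set) = vec.dim {x}"
    by (metis vec.dim_span)
  also have "\<dots> \<le> 1" by simp
  finally show False
    using assms by (simp add: card_cart_basis)
qed

text \<open>Sufficient criterion: if \<open>M\<close> lies inside the disk orbit of a single vector, then \<open>T\<close> is
  \<open>M\<close>-diskcyclic, because every set is contained in the closure of itself.\<close>

lemma M_diskcyclicI:
  assumes "M \<subseteq> {\<alpha> *s (T ^^ m) x | \<alpha> m. \<alpha> \<in> unit_disk}"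
  shows "M_diskcyclic T M"
  unfolding M_diskcyclic_def
  using assms closure_subset[of "{\<alpha> *s (T ^^ m) x | \<alpha> m. \<alpha> \<in> unit_disk} \<inter> M"]
  by blast

text \<open>Key lemma: a dilation by \<open>c\<close> with \<open>|c| > 1\<close> is diskcyclic on every line \<open>span {x}\<close>,
  with \<open>x\<close> itself as diskcyclic vector: \<open>k x = (k / c\<^sup>m) T\<^sup>m x\<close> with \<open>|k| < |c|\<^sup>m\<close>.\<close>

lemma dilation_M_diskcyclic_line:
  assumes c: "1 < cmod c"
  shows "M_diskcyclic ((*s) c) (vec.span {x :: complex ^ 'n})"
proof (rule M_diskcyclicI[where x = x])
  show "vec.span {x} \<subseteq> {\<alpha> *s ((*s) c ^^ m) x | \<alpha> m. \<alpha> \<in> unit_disk}"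
  proof
    fix v assume "v \<in> vec.span {x}"
    then obtain k where v: "v = k *s x"
      by (auto simp: vec.span_singleton)
    obtain m where m: "cmod k < cmod c ^ m"
      using real_arch_pow[OF c] by blast
    have c_pow: "0 < cmod c ^ m"
      using c by (intro zero_less_power) linarith
    have "v = (k / c ^ m) *s ((*s) c ^^ m) x"
      using c by (auto simp: v dilation_iterate vector_smult_assoc)
    moreover have "k / c ^ m \<in> unit_disk"
      using m c_pow by (simp add: unit_disk_def norm_divide norm_power)
    ultimately show "v \<in> {\<alpha> *s ((*s) c ^^ m) x | \<alpha> m. \<alpha> \<in> unit_disk}"
      by blast
  qed
qed

theorem mainTheorem10:
  assumes "CARD('n::finite) \<ge> 2"
  shows "\<exists>(T :: complex ^ 'n \<Rightarrow> complex ^ 'n) (M :: (complex ^ 'n) set).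
           Vector_Spaces.linear (*s) (*s) T \<and> bounded_linear T \<and>
           vec.subspace M \<and> M \<noteq> {0} \<and> M \<noteq> UNIV \<and>
           M_diskcyclic T M"
proof -
  define x :: "complex ^ 'n" where "x = axis undefined 1"
  have "x \<noteq> 0"
    by (simp add: x_def axis_eq_0_iff)
  then have "vec.span {x} \<noteq> {0}"
    by (rule span_singleton_nonzero)
  moreover have "M_diskcyclic ((*s) 2) (vec.span {x})"
    by (rule dilation_M_diskcyclic_line) simp
  ultimately show ?thesis
    using linear_dilation bounded_linear_dilation vec.subspace_span
      span_singleton_not_UNIV[OF assms]
    by blast
qed

end
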